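(* Let $G,H$ be graphs with $|V(G)|=n\ge 1$. If $\gamma_{st}(H)\ge 2$, then $\operatorname{st}_{\gamma_{st}}(G\circ H)=1$.
   Context: All graphs are finite, simple and undirected. For a graph $G=(V,E)$, a set $D\subseteq V$ is a strong dominating set if every vertex $v\in V\setminus D$ is adjacent to some $u\in D$ with $\deg(v)\le\deg(u)$ (degrees taken in $G$). The strong domination number $\gamma_{st}(G)$ is the minimum size of a strong dominating set. For $S\subseteq V$, $G-S$ is the graph obtained by deleting the vertices of $S$. The stability of the strong domination number is $\operatorname{st}_{\gamma_{st}}(G)=\min\{|S| : S\subseteq V,\ \gamma_{st}(G-S)\ne\gamma_{st}(G)\}$. The corona $G\circ H$ is obtained by taking one copy of $G$ and $|V(G)|$ copies of $H$, and joining each vertex of the $i$-th copy of $H$ to the $i$-th vertex of $G$. *)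

theory Defs
  imports "Graph_Theory.Digraph_Component" "Graph_Theory.Pair_Digraph"
begin

text \<open>
  Finite simple undirected graphs are the instances of the locale \<^locale>\<open>graph\<close>: finite,
  symmetric, loop-free digraphs without parallel arcs, the null graph included. An edge
  is a pair of opposite arcs, so the degree of a vertex is its \<^const>\<open>out_degree\<close>.
\<close>

definition strong_dominating_set :: "('a,'b) pre_digraph \<Rightarrow> 'a set \<Rightarrow> bool" where
  "strong_dominating_set G D \<longleftrightarrow>
     D \<subseteq> verts G \<and>
     (\<forall>v \<in> verts G - D. \<exists>u \<in> D. u \<rightarrow>\<^bsub>G\<^esub> v \<and> out_degree G v \<le> out_degree G u)"

definition strong_domination_number :: "('a,'b) pre_digraph \<Rightarrow> nat" where
  "strong_domination_number G = Min {card D | D. strong_dominating_set G D}"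

definition delete_verts :: "('a,'b) pre_digraph \<Rightarrow> 'a set \<Rightarrow> ('a,'b) pre_digraph" where
  "delete_verts G S = G \<restriction> (verts G - S)"

text \<open>
  \<^term>\<open>S = verts G\<close> is allowed and leaves the null graph, whose strong domination
  number is 0; hence the minimum is over a nonempty set unless \<open>G\<close> itself is null.
\<close>

definition strong_domination_stability :: "('a,'b) pre_digraph \<Rightarrow> nat" where
  "strong_domination_stability G =
     Min {card S | S. S \<subseteq> verts G \<and>
            strong_domination_number (delete_verts G S) \<noteq> strong_domination_number G}"

text \<open>
  \<^term>\<open>Inl g\<close> is the vertex \<open>g\<close> of \<open>G\<close>, and \<^term>\<open>Inr (g, x)\<close> is the vertex \<open>x\<close> in the
  copy of \<open>H\<close> attached to \<open>g\<close>.
\<close>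

definition corona ::
  "('a,'b) pre_digraph \<Rightarrow> ('c,'d) pre_digraph \<Rightarrow>
   ('a + 'a \<times> 'c, ('a + 'a \<times> 'c) \<times> ('a + 'a \<times> 'c)) pre_digraph" where
  "corona G H = with_proj
     \<lparr> pverts = verts G <+> (verts G \<times> verts H),
       parcs =
         {(Inl u, Inl v) | u v. u \<rightarrow>\<^bsub>G\<^esub> v} \<union>
         {(Inr (g, x), Inr (g, y)) | g x y. g \<in> verts G \<and> x \<rightarrow>\<^bsub>H\<^esub> y} \<union>
         {(Inl g, Inr (g, x)) | g x. g \<in> verts G \<and> x \<in> verts H} \<union>
         {(Inr (g, x), Inl g) | g x. g \<in> verts G \<and> x \<in> verts H} \<rparr>"

lemma graph_corona:
  assumes "graph G" "graph H"
  shows "graph (corona G H)"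
proof -
  interpret G: graph G by fact
  interpret H: graph H by fact
  let ?V = "verts (corona G H)" and ?A = "arcs (corona G H)"
  have sub: "?A \<subseteq> ?V \<times> ?V"
    by (auto simp: corona_def with_proj_def)
  have "finite ?V"
    by (simp add: corona_def with_proj_def)
  moreover have "finite ?A"
    using sub \<open>finite ?V\<close> by (meson finite_SigmaI finite_subset)
  moreover have "tail (corona G H) = fst" "head (corona G H) = snd"
    by (simp_all add: corona_def with_proj_def)
  moreover have "fst e \<noteq> snd e" if "e \<in> ?A" for e
    using that by (auto simp: corona_def with_proj_def dest: G.adj_not_same H.adj_not_same)
  moreover have "sym ?A"
    by (rule symI) (auto simp: corona_def with_proj_def
        intro: G.graph_symmetric H.graph_symmetric)
  moreover have "arcs_ends (corona G H) = ?A"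
    using calculation by (simp add: arcs_ends_conv)
  ultimately show ?thesis
    using sub by unfold_locales (auto simp: symmetric_def arc_to_ends_def)
qed

lemma graph_delete_verts:
  assumes "graph G"
  shows "graph (delete_verts G S)"
proof -
  interpret G: graph G by fact
  have "symmetric (delete_verts G S)"
    unfolding delete_verts_def
    by (rule induced_graph_imp_symmetric[OF G.sym_arcs G.induced_induce]) auto
  then show ?thesis
    by unfold_locales
      (auto simp: delete_verts_def arc_to_ends_def dest: G.no_loops intro: G.no_multi_arcs)
qed

end

theory Submission
  imports Defs
begin

text \<open>
  Since \<open>\<gamma>\<^sub>s\<^sub>t(H) \<ge> 2\<close>, no vertex of \<open>H\<close> is universal, so in the corona each vertex of \<open>G\<close> has
  larger degree than the vertices of its copy of \<open>H\<close>. Hence \<open>V(G)\<close> is strong dominating, and it is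
  minimum because every copy of \<open>H\<close>, taken together with its centre, must meet a strong dominating
  set. After deleting one vertex \<open>g\<close> of \<open>G\<close>, the copy of \<open>H\<close> at \<open>g\<close> becomes a separate union of
  components and needs at least two vertices of its own, so the strong domination number rises.
\<close>

section \<open>Degrees, vertex deletion and strong domination in general\<close>

lemma (in graph) out_degree_eq_card_neighbours:
  "out_degree G u = card {v. u \<rightarrow>\<^bsub>G\<^esub> v}"
proof -
  have "inj_on (head G) (out_arcs G u)"
    by (rule inj_onI) (auto intro: no_multi_arcs simp: arc_to_ends_def)
  moreover have "head G ` out_arcs G u = {v. u \<rightarrow>\<^bsub>G\<^esub> v}"
    by (auto simp: arcs_ends_def arc_to_ends_def image_iff)
  ultimately show ?thesis
    unfolding out_degree_def by (metis card_image)
qed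

lemma adj_delete_verts:
  "u \<rightarrow>\<^bsub>delete_verts G S\<^esub> v \<longleftrightarrow> u \<rightarrow>\<^bsub>G\<^esub> v \<and> u \<in> verts G - S \<and> v \<in> verts G - S"
  by (auto simp: delete_verts_def arcs_ends_def arc_to_ends_def image_iff)

lemma verts_delete_verts: "verts (delete_verts G S) = verts G - S"
  by (simp add: delete_verts_def)

lemma (in wf_digraph) delete_verts_empty: "delete_verts G {} = G"
proof -
  have "{a \<in> arcs G. tail G a \<in> verts G \<and> head G a \<in> verts G} = arcs G"
    by auto
  then show ?thesis
    by (simp add: delete_verts_def induce_subgraph_def)
qed

context fin_digraph
begin

lemma finite_strong_dominating_set_cards: "finite {card D | D. strong_dominating_set G D}"
  by (rule finite_subset[of _ "card ` Pow (verts G)"]) (auto simp: strong_dominating_set_def)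

lemma strong_domination_number_le:
  "strong_dominating_set G D \<Longrightarrow> strong_domination_number G \<le> card D"
  unfolding strong_domination_number_def
  by (rule Min_le[OF finite_strong_dominating_set_cards]) auto

lemma strong_domination_number_attained:
  obtains D where "strong_dominating_set G D" "card D = strong_domination_number G"
proof -
  \<comment> \<open>The full vertex set makes the set of cardinalities nonempty, so its
    \<open>Min\<close> is attained.\<close>
  have "strong_dominating_set G (verts G)"
    by (simp add: strong_dominating_set_def)
  then have "strong_domination_number G \<in> {card D | D. strong_dominating_set G D}"
    unfolding strong_domination_number_def
    by (intro Min_in[OF finite_strong_dominating_set_cards]) auto
  then show ?thesis
    using that by auto
qed

lemma verts_nonempty:
  assumes "strong_domination_number G > 0"
  shows "verts G \<noteq> {}"
  \<comment> \<open>In a null graph the empty set would force the value 0.\<close>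
  using assms strong_domination_number_le[of "{}"] by (auto simp: strong_dominating_set_def)

end

text \<open>A vertex violating the bound is adjacent to all others, so it has the largest possible
  degree and is strong dominating by itself.\<close>

lemma (in graph) out_degree_Suc_less_card_verts:
  assumes "strong_domination_number G \<ge> 2" "x \<in> verts G"
  shows "Suc (out_degree G x) < card (verts G)"
proof (rule ccontr)
  assume neg: "\<not> Suc (out_degree G x) < card (verts G)"
  have nbs: "{v. u \<rightarrow>\<^bsub>G\<^esub> v} \<subseteq> verts G - {u}" for u
    by (auto dest: adj_not_same)
  have bound: "out_degree G u \<le> card (verts G) - 1" if "u \<in> verts G" for u
    using card_mono[OF _ nbs[of u]] that by (simp add: out_degree_eq_card_neighbours)
  have "card (verts G - {x}) \<le> card {v. x \<rightarrow>\<^bsub>G\<^esub> v}"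
    using neg assms(2) by (simp add: out_degree_eq_card_neighbours)
  then have univ: "{v. x \<rightarrow>\<^bsub>G\<^esub> v} = verts G - {x}"
    using nbs[of x] by (intro card_seteq) auto
  then have "out_degree G x = card (verts G) - 1"
    using assms(2) by (simp add: out_degree_eq_card_neighbours)
  then have "strong_dominating_set G {x}"
    using univ bound assms(2) by (auto simp: strong_dominating_set_def)
  then show False
    using strong_domination_number_le[of "{x}"] assms(1) by simp
qed

section \<open>Adjacency and degrees in the corona\<close>

lemma verts_corona: "verts (corona G H) = verts G <+> verts G \<times> verts H"
  by (simp add: corona_def)

lemma arcs_ends_corona:
  "arcs_ends (corona G H) =
     {(Inl u, Inl v) | u v. u \<rightarrow>\<^bsub>G\<^esub> v} \<union>
     {(Inr (g, x), Inr (g, y)) | g x y. g \<in> verts G \<and> x \<rightarrow>\<^bsub>H\<^esub> y} \<union>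
     {(Inl g, Inr (g, x)) | g x. g \<in> verts G \<and> x \<in> verts H} \<union>
     {(Inr (g, x), Inl g) | g x. g \<in> verts G \<and> x \<in> verts H}"
  by (simp add: corona_def arcs_ends_conv with_proj_def)

locale corona_of_graphs =
  G: graph G + H: graph H for G :: "('a,'b) pre_digraph" and H :: "('c,'d) pre_digraph"
begin

sublocale C: graph "corona G H"
  by (intro graph_corona G.graph_axioms H.graph_axioms)

text \<open>The copy at \<open>g\<close> alone supplies this many neighbours; those inside
  \<open>G\<close> are left uncounted.\<close>

lemma card_verts_le_out_degree_Inl:
  assumes "g \<in> verts G"
  shows "card (verts H) \<le> out_degree (corona G H) (Inl g)"
proof -
  have "finite {v. Inl g \<rightarrow>\<^bsub>corona G H\<^esub> v}"
    by (rule finite_subset[OF _ C.finite_verts]) (auto dest: C.adj_in_verts)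
  then have "card ((\<lambda>x. Inr (g, x) :: 'a + 'a \<times> 'c) ` verts H) \<le> card {v. Inl g \<rightarrow>\<^bsub>corona G H\<^esub> v}"
    using assms by (intro card_mono) (auto simp: arcs_ends_corona)
  then show ?thesis
    by (simp add: C.out_degree_eq_card_neighbours card_image inj_on_def)
qed

lemma out_degree_Inr:
  assumes "g \<in> verts G" "x \<in> verts H"
  shows "out_degree (corona G H) (Inr (g, x)) = Suc (out_degree H x)"
proof -
  \<comment> \<open>The edge to the centre \<open>Inl g\<close> accounts for the
    \<open>Suc\<close>.\<close>
  have eq: "{v. Inr (g, x) \<rightarrow>\<^bsub>corona G H\<^esub> v} =
      insert (Inl g) ((\<lambda>y. Inr (g, y)) ` {y. x \<rightarrow>\<^bsub>H\<^esub> y})"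
    using assms by (auto simp: arcs_ends_corona)
  have "finite {y. x \<rightarrow>\<^bsub>H\<^esub> y}"
    by (rule finite_subset[OF _ H.finite_verts]) (auto dest: H.adj_in_verts)
  moreover have "Inl g \<notin> (\<lambda>y. Inr (g, y)) ` {y. x \<rightarrow>\<^bsub>H\<^esub> y}"
    by auto
  ultimately show ?thesis
    by (simp add: C.out_degree_eq_card_neighbours H.out_degree_eq_card_neighbours eq
        card_image inj_on_def)
qed

section \<open>Strong domination number of the corona\<close>

lemma strong_dominating_set_centres:
  assumes "strong_domination_number H \<ge> 2"
  shows "strong_dominating_set (corona G H) (Inl ` verts G)"
proof -
  \<comment> \<open>A copy vertex gains one edge, to its centre, while the centre sees the whole
    copy; the degree bound in \<open>H\<close> compares the two.\<close>
  have "Inl g \<rightarrow>\<^bsub>corona G H\<^esub> Inr (g, x) \<and>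
      out_degree (corona G H) (Inr (g, x)) \<le> out_degree (corona G H) (Inl g)"
    if "g \<in> verts G" "x \<in> verts H" for g x
    using that H.out_degree_Suc_less_card_verts[OF assms, of x]
      card_verts_le_out_degree_Inl[of g] out_degree_Inr[of g x]
    by (auto simp: arcs_ends_corona)
  then show ?thesis
    by (fastforce simp: strong_dominating_set_def verts_corona)
qed

text \<open>Sorts the vertices into blocks, each a vertex of \<open>G\<close> with its copy of
  \<open>H\<close>; members of a dominating set with distinct centres are distinct, which drives
  both lower bounds.\<close>

abbreviation centre :: "'a + 'a \<times> 'c \<Rightarrow> 'a" where
  "centre \<equiv> case_sum id fst"

text \<open>All neighbours of a copy vertex lie in its own block, so dominating one such vertex puts
  a member of \<open>D\<close> there. The parameter \<open>T\<close> serves both the intact corona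
  (\<open>T = {}\<close>) and the corona without one centre.\<close>

lemma strong_dominating_set_meets_copy:
  assumes "strong_dominating_set (delete_verts (corona G H) (Inl ` T)) D"
    and "verts H \<noteq> {}" "g \<in> verts G"
  shows "\<exists>d \<in> D. centre d = g \<and> (g \<in> T \<longrightarrow> d \<notin> range Inl)"
proof -
  obtain x where x: "x \<in> verts H"
    using assms(2) by blast
  show ?thesis
  proof (cases "Inr (g, x) \<in> D")
    case True
    then show ?thesis by force
  next
    case False
    then obtain u where "u \<in> D" "u \<rightarrow>\<^bsub>corona G H\<^esub> Inr (g, x)" "u \<notin> Inl ` T"
      using assms x unfolding strong_dominating_set_def verts_delete_verts adj_delete_verts
      by (force simp: verts_corona)
    then show ?thesis
      by (intro bexI[of _ u]) (auto simp: arcs_ends_corona)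
  qed
qed

lemma strong_domination_number_corona:
  assumes "strong_domination_number H \<ge> 2"
  shows "strong_domination_number (corona G H) = card (verts G)"
proof (rule antisym)
  show "strong_domination_number (corona G H) \<le> card (verts G)"
    using C.strong_domination_number_le[OF strong_dominating_set_centres[OF assms]]
    by (simp add: card_image)
next
  obtain D where D: "strong_dominating_set (corona G H) D"
    "card D = strong_domination_number (corona G H)"
    by (rule C.strong_domination_number_attained)
  \<comment> \<open>Nothing is deleted here, hence \<open>T = {}\<close>; each block meets
    \<open>D\<close>.\<close>
  have "verts G \<subseteq> centre ` D"
    using strong_dominating_set_meets_copy[of "{}" D] D(1) H.verts_nonempty assms
    by (force simp: C.delete_verts_empty)
  moreover have "finite D"
    using D(1) by (auto simp: strong_dominating_set_def intro: finite_subset[OF _ C.finite_verts])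
  ultimately show "card (verts G) \<le> strong_domination_number (corona G H)"
    using D(2) by (metis surj_card_le)
qed

section \<open>Deleting a centre\<close>

text \<open>Without \<open>Inl g\<close> the copy at \<open>g\<close> is detached and its vertices
  lose exactly the neighbour added by the corona, so adjacency and degrees there are again those of
  \<open>H\<close>.\<close>

lemma strong_dominating_set_restrict_copy:
  assumes "strong_dominating_set (delete_verts (corona G H) {Inl g}) D" "g \<in> verts G"
  shows "strong_dominating_set H {x. Inr (g, x) \<in> D}"
proof -
  let ?K = "delete_verts (corona G H) {Inl g}"
  interpret K: graph ?K
    by (intro graph_delete_verts C.graph_axioms)
  have adj: "u \<rightarrow>\<^bsub>?K\<^esub> Inr (g, x) \<longleftrightarrow> (\<exists>y. u = Inr (g, y) \<and> y \<rightarrow>\<^bsub>H\<^esub> x)" for u x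
    using assms(2) by (auto simp: adj_delete_verts arcs_ends_corona verts_corona
        dest: H.adj_in_verts)
  have deg: "out_degree ?K (Inr (g, x)) = out_degree H x" for x
  proof -
    have "{v. Inr (g, x) \<rightarrow>\<^bsub>?K\<^esub> v} = (\<lambda>y. Inr (g, y)) ` {y. x \<rightarrow>\<^bsub>H\<^esub> y}"
      using assms(2) by (auto simp: adj_delete_verts arcs_ends_corona verts_corona
          dest: H.adj_in_verts)
    then show ?thesis
      by (simp add: K.out_degree_eq_card_neighbours H.out_degree_eq_card_neighbours
          card_image inj_on_def)
  qed
  show ?thesis
    unfolding strong_dominating_set_def
  proof (intro conjI ballI)
    show "{x. Inr (g, x) \<in> D} \<subseteq> verts H"
      using assms(1) by (auto simp: strong_dominating_set_def verts_delete_verts verts_corona)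
  next
    fix x assume "x \<in> verts H - {x. Inr (g, x) \<in> D}"
    then have "Inr (g, x) \<in> verts ?K - D"
      using assms(2) by (auto simp: verts_delete_verts verts_corona)
    then obtain u where "u \<in> D" "u \<rightarrow>\<^bsub>?K\<^esub> Inr (g, x)"
      "out_degree ?K (Inr (g, x)) \<le> out_degree ?K u"
      using assms(1) unfolding strong_dominating_set_def by blast
    then show "\<exists>y \<in> {x. Inr (g, x) \<in> D}. y \<rightarrow>\<^bsub>H\<^esub> x \<and> out_degree H x \<le> out_degree H y"
      by (auto simp: adj deg)
  qed
qed

text \<open>The summands bound disjoint parts of a dominating set: a vertex from each other block,
  and a strong dominating set of \<open>H\<close> in the detached copy.\<close>

lemma strong_domination_number_delete_centre:
  assumes "verts H \<noteq> {}" "g \<in> verts G"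
  shows "card (verts G) - 1 + strong_domination_number H
    \<le> strong_domination_number (delete_verts (corona G H) {Inl g})"
proof -
  let ?K = "delete_verts (corona G H) {Inl g}"
  interpret K: graph ?K
    by (intro graph_delete_verts C.graph_axioms)
  obtain D where D: "strong_dominating_set ?K D" "card D = strong_domination_number ?K"
    by (rule K.strong_domination_number_attained)
  have "finite D"
    using D(1) by (auto simp: strong_dominating_set_def intro: finite_subset[OF _ K.finite_verts])
  let ?D1 = "{d \<in> D. centre d \<noteq> g}" and ?D2 = "(\<lambda>x. Inr (g, x) :: 'a + 'a \<times> 'c) ` {x. Inr (g, x) \<in> D}"
  have "verts G - {g} \<subseteq> centre ` ?D1"
    using strong_dominating_set_meets_copy[of "{g}" D] D(1) assms(1) by fastforce
  then have "card (verts G - {g}) \<le> card ?D1"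
    using \<open>finite D\<close> by (intro surj_card_le) auto
  moreover have "strong_domination_number H \<le> card ?D2"
    using H.strong_domination_number_le[OF strong_dominating_set_restrict_copy[OF D(1) assms(2)]]
    by (simp add: card_image inj_on_def)
  moreover have "card ?D1 + card ?D2 = card (?D1 \<union> ?D2)"
    using \<open>finite D\<close> by (intro card_Un_disjoint[symmetric]) (auto intro: finite_subset)
  moreover have "card (?D1 \<union> ?D2) \<le> card D"
    using \<open>finite D\<close> by (intro card_mono) auto
  ultimately show ?thesis
    using D(2) assms(2) by simp
qed

end

lemma (in graph) strong_domination_stability_eq_1:
  assumes "v \<in> verts G"
    and "strong_domination_number (delete_verts G {v}) \<noteq> strong_domination_number G"
  shows "strong_domination_stability G = 1"
  unfolding strong_domination_stability_def
proof (rule Min_eqI)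
  show "finite {card S | S. S \<subseteq> verts G \<and>
      strong_domination_number (delete_verts G S) \<noteq> strong_domination_number G}"
    by (rule finite_subset[of _ "card ` Pow (verts G)"]) auto
next
  fix k
  assume "k \<in> {card S | S. S \<subseteq> verts G \<and>
      strong_domination_number (delete_verts G S) \<noteq> strong_domination_number G}"
  then obtain S where S: "k = card S" "S \<subseteq> verts G"
    "strong_domination_number (delete_verts G S) \<noteq> strong_domination_number G"
    by blast
  \<comment> \<open>Deleting nothing leaves the number unchanged.\<close>
  then have "S \<noteq> {}" "finite S"
    by (auto simp: delete_verts_empty intro: finite_subset[OF _ finite_verts])
  then show "1 \<le> k"
    using S(1) by (simp add: Suc_le_eq card_gt_0_iff)
next
  show "1 \<in> {card S | S. S \<subseteq> verts G \<and>
      strong_domination_number (delete_verts G S) \<noteq> strong_domination_number G}"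
    using assms by (auto intro!: exI[of _ "{v}"])
qed

theorem proposition4p4:
  fixes G :: "('a,'b) pre_digraph" and H :: "('c,'d) pre_digraph" and n :: nat
  assumes "graph G" and "graph H"
    and "card (verts G) = n" and "n \<ge> 1"
    and "strong_domination_number H \<ge> 2"
  shows "strong_domination_stability (corona G H) = 1"
proof -
  interpret corona_of_graphs G H
    using assms(1,2) by (simp add: corona_of_graphs_def)
  obtain g where g: "g \<in> verts G"
    using assms(3,4) by (metis card.empty ex_in_conv not_one_le_zero)
  have "verts H \<noteq> {}"
    using H.verts_nonempty assms(5) by simp
  \<comment> \<open>The lower bound \<open>n - 1\<close> plus at least 2 exceeds \<open>n\<close>,
    the value for the intact corona.\<close>
  then have "card (verts G) < strong_domination_number (delete_verts (corona G H) {Inl g})"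
    using strong_domination_number_delete_centre[OF _ g] assms(3-5) by linarith
  then show ?thesis
    using g strong_domination_number_corona[OF assms(5)]
    by (intro C.strong_domination_stability_eq_1[of "Inl g"]) (auto simp: verts_corona)
qed

end
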